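(* The Mathieu group $M_{11}$ is generated by symbols $a,T,J,U$, subject to the defining relations $$T^2=J^2=(JT)^3=(Ta^2)^3=[J,a]^4=(J[J,a])^2=1,\quad a^2=[J,a]^2,\quad (aT)^2=T^{[J,a]},$$ $$U^2=(UT)^2=(UJ)^3=1,\quad a^U=[J,a].$$
   Context: Conventions: $[x,y]=xyx^{-1}y^{-1}$, $x^y=y^{-1}xy$; permutations are composed from right to left. The statement means that the abstract group with this presentation is isomorphic to $M_{11}$, with the symbols corresponding to the following permutations. Let $K=GF(3^2)$ with prime field $\Pi=GF(3)$, and $\zeta\in K$ with $\zeta^2=1-\zeta$ (a primitive element, so $\{1,\zeta\}$ is a $\Pi$-basis of $K$). Let $v\notin K\cup\{\infty\}$ be a new point and $\Omega'=K\cup\{\infty,v\}$ (11 points). $M_{11}$ is the sharply 4-transitive permutation group on $\Omega'$ generated by: $a:\omega\mapsto\zeta^{-1}\omega^3$, $T:\omega\mapsto1-\omega$, $J:\omega\mapsto\omega^{-1}$ (permutations of $K\cup\{\infty\}$ extended by fixing $v$; they generate the group $\mathrm{M}(3^2)$), and $U$ given by $U(\infty)=v$, $U(v)=\infty$, $U(\alpha+\zeta\beta)=\alpha-\zeta\beta$ for $\alpha,\beta\in\Pi$. *)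

theory Defs
  imports "HOL-Algebra.Algebra" "HOL-Library.Cardinality"
begin

section \<open>Group presentations\<close>

text \<open>A word is a list of letters; \<open>(s, True)\<close> stands for the generator \<open>s\<close> and
  \<open>(s, False)\<close> for its formal inverse.\<close>

type_synonym 's word = "('s \<times> bool) list"

inductive free_cancel :: "'s word \<Rightarrow> 's word \<Rightarrow> bool" where
  "free_cancel (u @ [(s, b), (s, \<not> b)] @ v) (u @ v)"

definition free_eq :: "('s word \<times> 's word) set" where
  "free_eq = {(u, v). equivclp free_cancel u v}"

definition free_group :: "'s word set monoid" where
  "free_group =
     \<lparr>carrier = UNIV // free_eq,
      monoid.mult = (\<lambda>A B. free_eq `` {u @ v | u v. u \<in> A \<and> v \<in> B}),
      one = free_eq `` {[]}\<rparr>"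

definition free_gen :: "'s \<Rightarrow> 's word set" where
  "free_gen s = free_eq `` {[(s, True)]}"

definition normal_closure :: "('a, 'b) monoid_scheme \<Rightarrow> 'a set \<Rightarrow> 'a set" where
  "normal_closure G R = \<Inter> {N. N \<lhd> G \<and> R \<subseteq> N}"

text \<open>A set of relations is given by pairs of elements of the free group, the pair \<open>(x, y)\<close>
  standing for the relation \<open>x = y\<close>.\<close>

definition relation_subgroup :: "('s word set \<times> 's word set) set \<Rightarrow> 's word set set" where
  "relation_subgroup R =
     normal_closure free_group
       {x \<otimes>\<^bsub>free_group\<^esub> inv\<^bsub>free_group\<^esub> y | x y. (x, y) \<in> R}"

definition presented_group :: "('s word set \<times> 's word set) set \<Rightarrow> 's word set set monoid" where
  "presented_group R = free_group Mod relation_subgroup R"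

definition presented_gen :: "('s word set \<times> 's word set) set \<Rightarrow> 's \<Rightarrow> 's word set set" where
  "presented_gen R s = relation_subgroup R #>\<^bsub>free_group\<^esub> free_gen s"

lemma equiv_free_eq: "equiv UNIV free_eq"
proof (rule equivI)
  show "refl free_eq" by (auto simp: free_eq_def intro: refl_onI)
  show "sym free_eq" by (rule symI) (simp add: free_eq_def equivclp_sym)
  show "trans free_eq" by (rule transI) (simp add: free_eq_def, metis equivclp_trans)
qed simp

lemma free_cancel_append:
  assumes "free_cancel u v"
  shows "free_cancel (p @ u @ q) (p @ v @ q)"
  using assms
proof cases
  case (1 u' s b v')
  then show ?thesis
    using free_cancel.intros[of "p @ u'" s b "v' @ q"] by simp
qed

lemma equivclp_free_cancel_append:
  assumes "equivclp free_cancel u v"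
  shows "equivclp free_cancel (p @ u @ q) (p @ v @ q)"
  using assms
proof (induction rule: equivclp_induct)
  case base
  then show ?case by simp
next
  case (step y z)
  then have "free_cancel (p @ y @ q) (p @ z @ q) \<or> free_cancel (p @ z @ q) (p @ y @ q)"
    using free_cancel_append by blast
  then show ?case
    using step.IH by (meson equivclp_into_equivclp)
qed

lemma free_eq_append:
  assumes "(u, u') \<in> free_eq" "(v, v') \<in> free_eq"
  shows "(u @ v, u' @ v') \<in> free_eq"
proof -
  have "equivclp free_cancel (u @ v) (u' @ v)"
    using equivclp_free_cancel_append[of u u' "[]" v] assms(1) by (simp add: free_eq_def)
  moreover have "equivclp free_cancel (u' @ v) (u' @ v')"
    using equivclp_free_cancel_append[of v v' u' "[]"] assms(2) by (simp add: free_eq_def)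
  ultimately show ?thesis
    by (simp add: free_eq_def) (metis equivclp_trans)
qed

lemma free_group_mult:
  "free_eq `` {u} \<otimes>\<^bsub>free_group\<^esub> free_eq `` {v} = free_eq `` {u @ v}"
proof -
  have r: "(u @ v, w) \<in> free_eq" if "(u, u') \<in> free_eq" "(v, v') \<in> free_eq" "(u' @ v', w) \<in> free_eq"
    for u' v' w
    using free_eq_append[OF that(1,2)] that(3) equiv_free_eq by (meson equivE transD)
  have "(u, u) \<in> free_eq" "(v, v) \<in> free_eq"
    by (simp_all add: free_eq_def)
  then show ?thesis
    unfolding free_group_def monoid.simps using r by blast
qed

lemma free_eq_inverse_word:
  "(map (\<lambda>(s, b). (s, \<not> b)) (rev w) @ w, []) \<in> free_eq"
proof (induction w)
  case Nil
  then show ?case by (simp add: free_eq_def)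
next
  case (Cons x w)
  obtain s b where x: "x = (s, b)" by fastforce
  let ?i = "map (\<lambda>(s, b). (s, \<not> b)) (rev w) :: 'a word"
  have "free_cancel (?i @ [(s, \<not> b), (s, \<not> \<not> b)] @ w) (?i @ w)"
    by (rule free_cancel.intros)
  then have "equivclp free_cancel (?i @ [(s, \<not> b), (s, b)] @ w) (?i @ w)"
    by auto
  moreover have "equivclp free_cancel (?i @ w) []"
    using Cons by (simp add: free_eq_def)
  ultimately have "equivclp free_cancel (?i @ [(s, \<not> b), (s, b)] @ w) []"
    by (rule equivclp_trans)
  then show ?case
    by (simp add: free_eq_def x)
qed

lemma group_free_group: "group (free_group :: 's word set monoid)"
proof (rule groupI)
  have carr: "carrier free_group = range (\<lambda>w :: 's word. free_eq `` {w})"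
    by (auto simp: free_group_def quotient_def)
  have one: "\<one>\<^bsub>free_group\<^esub> = free_eq `` {[] :: 's word}"
    by (simp add: free_group_def)
  show "\<one>\<^bsub>free_group\<^esub> \<in> carrier (free_group :: 's word set monoid)"
    by (simp add: carr one)
  fix x y z :: "'s word set"
  assume "x \<in> carrier free_group"
  then obtain u where x: "x = free_eq `` {u}" by (auto simp: carr)
  show "\<one>\<^bsub>free_group\<^esub> \<otimes>\<^bsub>free_group\<^esub> x = x"
    by (simp add: one x free_group_mult)
  have "free_eq `` {map (\<lambda>(s, b). (s, \<not> b)) (rev u) @ u} = free_eq `` {[]}"
    using equiv_class_eq[OF equiv_free_eq free_eq_inverse_word] .
  then have "free_eq `` {map (\<lambda>(s, b). (s, \<not> b)) (rev u)} \<otimes>\<^bsub>free_group\<^esub> x = \<one>\<^bsub>free_group\<^esub>"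
    by (simp add: one x free_group_mult)
  then show "\<exists>y\<in>carrier free_group. y \<otimes>\<^bsub>free_group\<^esub> x = \<one>\<^bsub>free_group\<^esub>"
    by (auto simp: carr)
  assume "y \<in> carrier free_group"
  then obtain v where y: "y = free_eq `` {v}" by (auto simp: carr)
  show "x \<otimes>\<^bsub>free_group\<^esub> y \<in> carrier free_group"
    by (simp add: x y free_group_mult carr)
  assume "z \<in> carrier free_group"
  then obtain w where z: "z = free_eq `` {w}" by (auto simp: carr)
  show "x \<otimes>\<^bsub>free_group\<^esub> y \<otimes>\<^bsub>free_group\<^esub> z = x \<otimes>\<^bsub>free_group\<^esub> (y \<otimes>\<^bsub>free_group\<^esub> z)"
    by (simp add: x y z free_group_mult)
qed

section \<open>The Mathieu group on eleven points\<close>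

datatype 'k point = Fin 'k | Infty | Extra

text \<open>The field \<open>K\<close> is the type \<open>'k\<close>, the new point \<open>v\<close> is \<open>Extra\<close>, and the set of eleven points
  is \<open>UNIV :: 'k point set\<close>. The multiplication of \<open>BijGroup UNIV\<close> composes from right to left.\<close>

definition perm_a :: "'k::field \<Rightarrow> 'k point \<Rightarrow> 'k point" where
  "perm_a \<zeta> p = (case p of Fin \<omega> \<Rightarrow> Fin (inverse \<zeta> * \<omega> ^ 3) | Infty \<Rightarrow> Infty | Extra \<Rightarrow> Extra)"

definition perm_T :: "'k::field point \<Rightarrow> 'k point" where
  "perm_T p = (case p of Fin \<omega> \<Rightarrow> Fin (1 - \<omega>) | Infty \<Rightarrow> Infty | Extra \<Rightarrow> Extra)"

definition perm_J :: "'k::field point \<Rightarrow> 'k point" where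
  "perm_J p = (case p of Fin \<omega> \<Rightarrow> if \<omega> = 0 then Infty else Fin (inverse \<omega>)
                       | Infty \<Rightarrow> Fin 0 | Extra \<Rightarrow> Extra)"

text \<open>In positive characteristic the prime field is the image of the integers.\<close>

definition prime_subfield :: "'k::field set" where
  "prime_subfield = range of_int"

text \<open>When \<open>K\<close> has nine elements and \<open>\<zeta>\<^sup>2 = 1 - \<zeta>\<close>, each \<open>\<omega>\<close> is uniquely \<open>\<alpha> + \<zeta> * \<beta>\<close> with \<open>\<alpha>\<close>, \<open>\<beta>\<close>
  in the prime field, so that the description below defines a unique element.\<close>

definition perm_U :: "'k::field \<Rightarrow> 'k point \<Rightarrow> 'k point" where
  "perm_U \<zeta> p = (case p of
       Fin \<omega> \<Rightarrow> Fin (THE \<omega>'. \<exists>\<alpha>\<in>prime_subfield. \<exists>\<beta>\<in>prime_subfield.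
                       \<omega> = \<alpha> + \<zeta> * \<beta> \<and> \<omega>' = \<alpha> - \<zeta> * \<beta>)
     | Infty \<Rightarrow> Extra
     | Extra \<Rightarrow> Infty)"

definition M11 :: "'k::field \<Rightarrow> ('k point \<Rightarrow> 'k point) monoid" where
  "M11 \<zeta> = (BijGroup UNIV)
     \<lparr>carrier := generate (BijGroup UNIV) {perm_a \<zeta>, perm_T, perm_J, perm_U \<zeta>}\<rparr>"

section \<open>The presentation\<close>

definition commutator :: "('a, 'b) monoid_scheme \<Rightarrow> 'a \<Rightarrow> 'a \<Rightarrow> 'a" where
  "commutator G x y = x \<otimes>\<^bsub>G\<^esub> y \<otimes>\<^bsub>G\<^esub> inv\<^bsub>G\<^esub> x \<otimes>\<^bsub>G\<^esub> inv\<^bsub>G\<^esub> y"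

definition conjugate :: "('a, 'b) monoid_scheme \<Rightarrow> 'a \<Rightarrow> 'a \<Rightarrow> 'a" where
  "conjugate G x y = inv\<^bsub>G\<^esub> y \<otimes>\<^bsub>G\<^esub> x \<otimes>\<^bsub>G\<^esub> y"

datatype m11_symbol = Sym_a | Sym_T | Sym_J | Sym_U

definition m11_relations :: "(m11_symbol word set \<times> m11_symbol word set) set" where
  "m11_relations =
    (let F = free_group; e = \<one>\<^bsub>F\<^esub>;
         a = free_gen Sym_a; T = free_gen Sym_T; J = free_gen Sym_J; U = free_gen Sym_U;
         c = commutator F J a
     in {(T [^]\<^bsub>F\<^esub> (2::nat), e),
         (J [^]\<^bsub>F\<^esub> (2::nat), e),
         ((J \<otimes>\<^bsub>F\<^esub> T) [^]\<^bsub>F\<^esub> (3::nat), e),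
         ((T \<otimes>\<^bsub>F\<^esub> a [^]\<^bsub>F\<^esub> (2::nat)) [^]\<^bsub>F\<^esub> (3::nat), e),
         (c [^]\<^bsub>F\<^esub> (4::nat), e),
         ((J \<otimes>\<^bsub>F\<^esub> c) [^]\<^bsub>F\<^esub> (2::nat), e),
         (a [^]\<^bsub>F\<^esub> (2::nat), c [^]\<^bsub>F\<^esub> (2::nat)),
         ((a \<otimes>\<^bsub>F\<^esub> T) [^]\<^bsub>F\<^esub> (2::nat), conjugate F T c),
         (U [^]\<^bsub>F\<^esub> (2::nat), e),
         ((U \<otimes>\<^bsub>F\<^esub> T) [^]\<^bsub>F\<^esub> (2::nat), e),
         ((U \<otimes>\<^bsub>F\<^esub> J) [^]\<^bsub>F\<^esub> (3::nat), e),
         (conjugate F a U, c)})"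

end

theory Submission
  imports Defs
begin

text \<open>Sending the symbols to the permutations defines a surjective homomorphism \<open>h\<close> from the presented group onto
  \<open>M\<^sub>1\<^sub>1\<close>, and only its injectivity needs work. With \<open>c = [J, a]\<close>, the relations make \<open>Q = \<langle>a,
  c\<rangle>\<close> a quaternion group, and they allow one to adjoin the involutions \<open>T\<close>, \<open>J\<close>, \<open>U\<close> one by one:
  \<open>B = Q \<union> Q T Q\<close>, \<open>H = B \<union> B J B\<close> and \<open>H \<union> H U H\<close> are subgroups, so that the last one is
  the whole group. At the first step this rests on the relations for \<open>T q T\<close> with \<open>q \<in> Q\<close>; at the other two steps the
  new involution normalises the previous but one subgroup and satisfies a braid relation with the previous involution. Now let \<open>h x = 1\<close>.
  As \<open>H\<close> fixes the point \<open>v\<close> and \<open>U\<close> moves it, no element of \<open>H U H\<close> fixes \<open>v\<close>, hence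
  \<open>x \<in> H\<close>. In the same way \<open>x \<in> B\<close> by looking at \<open>\<infinity>\<close>, and \<open>x \<in> Q\<close> by looking
  at \<open>0\<close>; finally only \<open>1 \<in> Q\<close> fixes the point \<open>1\<close>.\<close>

section \<open>Presented groups\<close>

lemma carrier_free_group: "carrier free_group = range (\<lambda>w. free_eq `` {w})"
  by (auto simp: free_group_def quotient_def)

lemma one_free_group: "\<one>\<^bsub>free_group\<^esub> = free_eq `` {[]}"
  by (simp add: free_group_def)

lemma free_gen_closed [simp]: "free_gen s \<in> carrier free_group"
  by (simp add: carrier_free_group free_gen_def)

lemma inv_free_gen: "inv\<^bsub>free_group\<^esub> free_gen s = free_eq `` {[(s, False)]}"
proof (rule group.inv_equality[OF group_free_group])
  show "free_eq `` {[(s, False)]} \<otimes>\<^bsub>free_group\<^esub> free_gen s = \<one>\<^bsub>free_group\<^esub>"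
    using equiv_class_eq[OF equiv_free_eq free_eq_inverse_word[of "[(s, True)]"]]
    by (simp add: free_gen_def free_group_mult one_free_group)
qed (auto simp: carrier_free_group free_gen_def)

lemma free_group_generated: "generate free_group (range free_gen) = carrier free_group"
proof
  show "generate free_group (range free_gen) \<subseteq> carrier free_group"
    by (intro group.generate_incl[OF group_free_group]) auto
  have "free_eq `` {w} \<in> generate free_group (range free_gen)" for w
  proof (induction w)
    case Nil
    then show ?case
      using generate.one[of free_group] by (simp add: one_free_group)
  next
    case (Cons x w)
    obtain s b where x: "x = (s, b)" by fastforce
    have "free_eq `` {[(s, b)]} \<in> generate free_group (range free_gen)"
      using generate.incl[of "free_gen s" _ free_group] generate.inv[of "free_gen s" _ free_group]
      by (cases b) (simp_all add: inv_free_gen, simp add: free_gen_def)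
    from generate.eng[OF this Cons.IH] show ?case
      by (simp add: free_group_mult x)
  qed
  then show "carrier free_group \<subseteq> generate free_group (range free_gen)"
    by (auto simp: carrier_free_group)
qed

section \<open>Evaluation of words and the universal property of the free group\<close>

definition word_value :: "('g, 'b) monoid_scheme \<Rightarrow> ('s \<Rightarrow> 'g) \<Rightarrow> 's word \<Rightarrow> 'g" where
  "word_value G g w =
     foldr (\<lambda>(s, b) x. (if b then g s else inv\<^bsub>G\<^esub> g s) \<otimes>\<^bsub>G\<^esub> x) w \<one>\<^bsub>G\<^esub>"

context group
begin

context
  fixes g :: "'s \<Rightarrow> 'a"
  assumes g: "\<And>s. g s \<in> carrier G"
begin

lemma word_value_closed: "word_value G g w \<in> carrier G"
  by (induction w) (auto simp: word_value_def g)

lemma word_value_append: "word_value G g (u @ v) = word_value G g u \<otimes> word_value G g v"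
proof (induction u)
  case Nil
  then show ?case using word_value_closed[of v] by (simp add: word_value_def)
next
  case (Cons x u)
  then show ?case
    using word_value_closed[of u] word_value_closed[of v]
    by (auto simp: word_value_def g m_assoc split: prod.split)
qed

lemma word_value_free_cancel:
  assumes "free_cancel u v"
  shows "word_value G g u = word_value G g v"
  using assms
proof cases
  case (1 u' s b v')
  have "word_value G g [(s, b), (s, \<not> b)] = \<one>"
    by (simp add: word_value_def g)
  then show ?thesis
    using word_value_closed by (simp add: 1 word_value_append del: append_Cons)
qed

lemma word_value_free_eq:
  assumes "(u, v) \<in> free_eq"
  shows "word_value G g u = word_value G g v"
proof -
  have "equivclp free_cancel u v"
    using assms by (simp add: free_eq_def)
  then show ?thesis
    by (induction rule: equivclp_induct) (auto dest: word_value_free_cancel)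
qed

lemma free_group_universal:
  obtains f where "f \<in> hom free_group G" "\<And>s. f (free_gen s) = g s"
proof
  \<comment> \<open>Evaluation is constant on each class of \<open>free_eq\<close>, so the image of
    a class is a singleton and \<open>the_elem\<close> extracts the common value.\<close>
  let ?f = "\<lambda>A. the_elem (word_value G g ` A)"
  have f: "?f (free_eq `` {w}) = word_value G g w" for w
  proof -
    have "word_value G g ` (free_eq `` {w}) = {word_value G g w}"
    proof (intro equalityI subsetI)
      show "x \<in> {word_value G g w}" if "x \<in> word_value G g ` (free_eq `` {w})" for x
        using that by (auto dest: word_value_free_eq)
      show "x \<in> word_value G g ` (free_eq `` {w})" if "x \<in> {word_value G g w}" for x
        using that equiv_class_self[OF equiv_free_eq, of w] by auto
    qed
    then show ?thesis by simp
  qed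
  show "?f \<in> hom free_group G"
    by (rule homI) (auto simp: carrier_free_group free_group_mult f word_value_closed word_value_append)
  show "?f (free_gen s) = g s" for s
    by (simp add: free_gen_def f) (simp add: word_value_def g)
qed

end

section \<open>Normal closures\<close>

lemma normal_closure_normal:
  assumes "S \<subseteq> carrier G"
  shows "normal_closure G S \<lhd> G"
proof -
  let ?N = "{N. N \<lhd> G \<and> S \<subseteq> N}"
  \<comment> \<open>At least one normal subgroup contains \<open>S\<close>; over an empty family the
    intersection would be the whole type.\<close>
  have "carrier G \<in> ?N"
    using assms by (simp add: normal_inv_iff subgroup_self)
  then have "subgroup (\<Inter> ?N) G"
    by (intro subgroups_Inter) (auto dest: normal_imp_subgroup)
  then show ?thesis
    by (auto simp: normal_inv_iff normal_closure_def)
qed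

end

lemma generator_subset_normal_closure: "S \<subseteq> normal_closure G S"
  by (auto simp: normal_closure_def)

lemma normal_closure_minimal: "N \<lhd> G \<Longrightarrow> S \<subseteq> N \<Longrightarrow> normal_closure G S \<subseteq> N"
  by (auto simp: normal_closure_def)

section \<open>Groups given by generators and relations\<close>

locale free_group_relations =
  fixes R :: "('s word set \<times> 's word set) set"
  assumes relation_closed: "\<And>x y. (x, y) \<in> R \<Longrightarrow> x \<in> carrier free_group \<and> y \<in> carrier free_group"
begin

sublocale F: group "free_group :: 's word set monoid"
  by (rule group_free_group)

lemma relators_closed:
  "{x \<otimes>\<^bsub>free_group\<^esub> inv\<^bsub>free_group\<^esub> y | x y. (x, y) \<in> R} \<subseteq> carrier free_group"
  using relation_closed by fastforce

sublocale normal "relation_subgroup R" free_group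
  unfolding relation_subgroup_def by (rule F.normal_closure_normal[OF relators_closed])

sublocale P: group "presented_group R"
  unfolding presented_group_def by (rule factorgroup_is_group)

lemma presentation_map_hom:
  "(\<lambda>x. relation_subgroup R #>\<^bsub>free_group\<^esub> x) \<in> hom free_group (presented_group R)"
  unfolding presented_group_def by (rule r_coset_hom_Mod)

sublocale presentation_map:
  group_hom free_group "presented_group R" "\<lambda>x. relation_subgroup R #>\<^bsub>free_group\<^esub> x"
  using presentation_map_hom by unfold_locales

lemma relation_holds:
  assumes "(x, y) \<in> R"
  shows "relation_subgroup R #>\<^bsub>free_group\<^esub> x = relation_subgroup R #>\<^bsub>free_group\<^esub> y"
proof -
  have "x \<otimes>\<^bsub>free_group\<^esub> inv\<^bsub>free_group\<^esub> y \<in> relation_subgroup R"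
    unfolding relation_subgroup_def
    by (rule subsetD[OF generator_subset_normal_closure]) (use assms in blast)
  moreover have "x \<in> carrier free_group" "y \<in> carrier free_group"
    using relation_closed assms by auto
  ultimately show ?thesis
    using F.coset_mult_inv1[OF F.coset_join2[OF _ subgroup_axioms]] subset by simp
qed

lemma presented_group_generated:
  "generate (presented_group R) (range (presented_gen R)) = carrier (presented_group R)"
proof -
  have "(\<lambda>x. relation_subgroup R #>\<^bsub>free_group\<^esub> x) ` generate free_group (range free_gen) =
      generate (presented_group R) ((\<lambda>x. relation_subgroup R #>\<^bsub>free_group\<^esub> x) ` range free_gen)"
    by (rule presentation_map.generate_img[symmetric]) auto
  moreover have "(\<lambda>x. relation_subgroup R #>\<^bsub>free_group\<^esub> x) ` carrier free_group =
      carrier (presented_group R)"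
    by (simp add: presented_group_def carrier_FactGroup)
  moreover have "(\<lambda>x. relation_subgroup R #>\<^bsub>free_group\<^esub> x) ` range free_gen = range (presented_gen R)"
    by (auto simp: presented_gen_def)
  ultimately show ?thesis
    by (simp add: free_group_generated)
qed

text \<open>The kernel of \<open>f\<close> is a normal subgroup containing all relators, hence their
  normal closure, so \<open>f\<close> factors through the quotient.\<close>

lemma presented_group_universal:
  assumes "group G" and f: "f \<in> hom free_group G"
    and R: "\<And>x y. (x, y) \<in> R \<Longrightarrow> f x = f y"
  obtains h where "h \<in> hom (presented_group R) G" "\<And>s. h (presented_gen R s) = f (free_gen s)"
proof -
  interpret f: group_hom free_group G f
    using assms by (intro group_hom.intro) (auto simp: group_hom_axioms_def F.group_axioms)
  have "relation_subgroup R \<subseteq> kernel free_group G f"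
    unfolding relation_subgroup_def
  proof (rule normal_closure_minimal[OF f.normal_kernel], safe)
    fix x y assume xy: "(x, y) \<in> R"
    then have "x \<in> carrier free_group" "y \<in> carrier free_group"
      using relation_closed by auto
    then show "x \<otimes>\<^bsub>free_group\<^esub> inv\<^bsub>free_group\<^esub> y \<in> kernel free_group G f"
      using R[OF xy] by (simp add: kernel_def)
  qed
  then obtain h where "h \<in> hom (presented_group R) G"
      and h: "\<And>x. x \<in> carrier free_group \<Longrightarrow> h (relation_subgroup R #>\<^bsub>free_group\<^esub> x) = f x"
    using f.FactGroup_universal_kernel[OF normal_axioms] unfolding presented_group_def by blast
  then show ?thesis
    using that by (simp add: presented_gen_def)
qed

end

section \<open>Adjoining an involution to a subgroup\<close>

text \<open>One step of a Bruhat-like decomposition: if \<open>B\<close> is a subgroup and this set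
  is one too, it is the subgroup generated by \<open>B\<close> and \<open>t\<close>.\<close>

definition double_coset_union :: "('a, 'b) monoid_scheme \<Rightarrow> 'a set \<Rightarrow> 'a \<Rightarrow> 'a set" where
  "double_coset_union G B t = B \<union> {x \<otimes>\<^bsub>G\<^esub> t \<otimes>\<^bsub>G\<^esub> y | x y. x \<in> B \<and> y \<in> B}"

lemma double_coset_union_base: "x \<in> B \<Longrightarrow> x \<in> double_coset_union G B t"
  by (simp add: double_coset_union_def)

lemma double_coset_union_mem:
  "x \<in> B \<Longrightarrow> y \<in> B \<Longrightarrow> x \<otimes>\<^bsub>G\<^esub> t \<otimes>\<^bsub>G\<^esub> y \<in> double_coset_union G B t"
  unfolding double_coset_union_def by blast

lemma double_coset_union_cases:
  assumes "d \<in> double_coset_union G B t"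
  obtains "d \<in> B" | x y where "d = x \<otimes>\<^bsub>G\<^esub> t \<otimes>\<^bsub>G\<^esub> y" "x \<in> B" "y \<in> B"
  using assms unfolding double_coset_union_def by blast

context group
begin

lemma involution_cancel:
  assumes "t \<in> carrier G" "t \<otimes> t = \<one>" "x \<in> carrier G"
  shows "t \<otimes> (t \<otimes> x) = x"
  using assms by (simp flip: m_assoc)

lemma involution_inv:
  assumes "t \<in> carrier G" "t \<otimes> t = \<one>"
  shows "inv t = t"
  using assms by (simp add: inv_equality)

text \<open>The word (xy)^3 splits as (xyx)(yxy), and yxy is its own inverse.\<close>

lemma braid_involutions:
  assumes "x \<in> carrier G" "y \<in> carrier G" "x \<otimes> x = \<one>" "y \<otimes> y = \<one>" "(x \<otimes> y) [^] (3::nat) = \<one>"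
  shows "x \<otimes> y \<otimes> x = y \<otimes> x \<otimes> y"
proof -
  have "(x \<otimes> y \<otimes> x) \<otimes> (y \<otimes> x \<otimes> y) = \<one>"
    using assms by (simp add: numeral_3_eq_3 m_assoc)
  then have "x \<otimes> y \<otimes> x = inv (y \<otimes> x \<otimes> y)"
    using assms by (simp add: inv_equality)
  also have "\<dots> = y \<otimes> x \<otimes> y"
    using assms by (simp add: inv_mult_group involution_inv m_assoc)
  finally show ?thesis .
qed

text \<open>Normalisation by \<open>m_assoc\<close> hides the product of \<open>x\<close> and
  \<open>y\<close> inside right-nested terms; in this form an equation for it can still be used
  there as a rewrite rule.\<close>

lemma mult_assoc_rule:
  assumes "x \<otimes> y = z" "x \<in> carrier G" "y \<in> carrier G" "w \<in> carrier G"
  shows "x \<otimes> (y \<otimes> w) = z \<otimes> w"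
  using assms by (simp flip: m_assoc)

text \<open>Only the middle part t(yx')t of a product (xty)(x'ty') needs care: \<open>B\<close>
  absorbs the outer factors, and inverses are harmless because t is its own inverse.\<close>

lemma double_coset_union_subgroup:
  assumes B: "subgroup B G" and t: "t \<in> carrier G" "t \<otimes> t = \<one>"
    and conj: "\<And>b. b \<in> B \<Longrightarrow> t \<otimes> b \<otimes> t \<in> double_coset_union G B t"
  shows "subgroup (double_coset_union G B t) G"
proof -
  interpret B: subgroup B G by (rule B)
  let ?D = "double_coset_union G B t"
  have left: "b \<otimes> d \<in> ?D" if "b \<in> B" "d \<in> ?D" for b d
    using that(2)
  proof (cases rule: double_coset_union_cases)
    case 1
    then show ?thesis
      using that by (simp add: double_coset_union_base)
  next
    case (2 x y)
    then have "b \<otimes> d = (b \<otimes> x) \<otimes> t \<otimes> y"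
      using t that(1) by (simp add: m_assoc)
    then show ?thesis
      using 2 that(1) by (simp add: double_coset_union_mem)
  qed
  have right: "d \<otimes> b \<in> ?D" if "b \<in> B" "d \<in> ?D" for b d
    using that(2)
  proof (cases rule: double_coset_union_cases)
    case 1
    then show ?thesis
      using that by (simp add: double_coset_union_base)
  next
    case (2 x y)
    then have "d \<otimes> b = x \<otimes> t \<otimes> (y \<otimes> b)"
      using t that(1) by (simp add: m_assoc)
    then show ?thesis
      using 2 that(1) by (simp add: double_coset_union_mem)
  qed
  have sub: "?D \<subseteq> carrier G"
    using t by (auto simp: double_coset_union_def)
  show ?thesis
  proof (rule subgroupI)
    show "?D \<subseteq> carrier G" by (rule sub)
    show "?D \<noteq> {}"
      using double_coset_union_base[OF B.one_closed] by blast
  next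
    fix d assume "d \<in> ?D"
    then show "inv d \<in> ?D"
    proof (cases rule: double_coset_union_cases)
      case 1
      then show ?thesis
        by (simp add: double_coset_union_base)
    next
      case (2 x y)
      then have "inv d = inv y \<otimes> t \<otimes> inv x"
        using t by (simp add: inv_mult_group m_assoc involution_inv)
      then show ?thesis
        using 2 by (simp add: double_coset_union_mem)
    qed
  next
    fix d e assume d: "d \<in> ?D" and e: "e \<in> ?D"
    from d show "d \<otimes> e \<in> ?D"
    proof (cases rule: double_coset_union_cases)
      case 1
      then show ?thesis using left e by blast
    next
      case d': (2 x y)
      from e show ?thesis
      proof (cases rule: double_coset_union_cases)
        case 1
        then show ?thesis using right d by blast
      next
        case e': (2 x' y')
        have "d \<otimes> e = x \<otimes> (t \<otimes> (y \<otimes> x') \<otimes> t) \<otimes> y'"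
          using d' e' t by (simp add: m_assoc)
        then show ?thesis
          using conj[of "y \<otimes> x'"] left right d' e' by simp
      qed
    qed
  qed
qed

text \<open>With x' = txt and y' = tyt in \<open>B\<close>, one has t(xsy)t = x'(tst)y' =
  (x's)t(sy'), so conjugation by t stays within the required double coset.\<close>

lemma double_coset_union_braid:
  assumes B: "subgroup B G" and D: "subgroup (double_coset_union G B s) G"
    and s: "s \<in> carrier G" and t: "t \<in> carrier G" "t \<otimes> t = \<one>"
    and norm: "\<And>b. b \<in> B \<Longrightarrow> t \<otimes> b \<otimes> t \<in> B"
    and braid: "t \<otimes> s \<otimes> t = s \<otimes> t \<otimes> s"
  shows "subgroup (double_coset_union G (double_coset_union G B s) t) G"
proof (rule double_coset_union_subgroup[OF D t])
  interpret B: subgroup B G by (rule B)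
  let ?D = "double_coset_union G B s"
  fix d assume "d \<in> ?D"
  then show "t \<otimes> d \<otimes> t \<in> double_coset_union G ?D t"
  proof (cases rule: double_coset_union_cases)
    case 1
    then show ?thesis
      using norm by (simp add: double_coset_union_base)
  next
    case (2 x y)
    define x' where "x' = t \<otimes> x \<otimes> t"
    define y' where "y' = t \<otimes> y \<otimes> t"
    have x': "x' \<in> B" "y' \<in> B"
      using norm 2 by (auto simp: x'_def y'_def)
    have "t \<otimes> d \<otimes> t = x' \<otimes> (t \<otimes> s \<otimes> t) \<otimes> y'"
      using 2 s t by (simp add: x'_def y'_def m_assoc involution_cancel)
    \<comment> \<open>The factors \<open>\<one>\<close> give x's and sy' the literal shape of
      elements of BsB.\<close>
    also have "\<dots> = (x' \<otimes> s \<otimes> \<one>) \<otimes> t \<otimes> (\<one> \<otimes> s \<otimes> y')"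
      unfolding braid using x' s t by (simp add: m_assoc)
    finally show ?thesis
      using double_coset_union_mem[OF double_coset_union_mem double_coset_union_mem] x' B.one_closed
      by metis
  qed
qed

end

section \<open>The double coset decomposition\<close>

text \<open>Stated for four elements of any group, so that the presented group and the permutations
  are both instances.\<close>

locale m11_group = group +
  fixes a T J U
  assumes closed: "a \<in> carrier G" "T \<in> carrier G" "J \<in> carrier G" "U \<in> carrier G"
    and T2: "T [^] (2::nat) = \<one>"
    and J2: "J [^] (2::nat) = \<one>"
    and JT3: "(J \<otimes> T) [^] (3::nat) = \<one>"
    and Ta3: "(T \<otimes> a [^] (2::nat)) [^] (3::nat) = \<one>"
    and c4: "commutator G J a [^] (4::nat) = \<one>"
    and Jc2: "(J \<otimes> commutator G J a) [^] (2::nat) = \<one>"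
    and a2: "a [^] (2::nat) = commutator G J a [^] (2::nat)"
    and aT2: "(a \<otimes> T) [^] (2::nat) = conjugate G T (commutator G J a)"
    and U2: "U [^] (2::nat) = \<one>"
    and UT2: "(U \<otimes> T) [^] (2::nat) = \<one>"
    and UJ3: "(U \<otimes> J) [^] (3::nat) = \<one>"
    and aU: "conjugate G a U = commutator G J a"
begin

section \<open>The relations rewritten as conjugation rules\<close>

definition c where "c = commutator G J a"

lemma gens_closed [simp]: "a \<in> carrier G" "T \<in> carrier G" "J \<in> carrier G" "U \<in> carrier G"
    "c \<in> carrier G"
  using closed by (simp_all add: c_def commutator_def)

lemma TT: "T \<otimes> T = \<one>" and JJ: "J \<otimes> J = \<one>" and UU: "U \<otimes> U = \<one>"
  using T2 J2 U2 by (simp_all add: power2_eq_square numeral_2_eq_2)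

lemmas T_cancel = involution_cancel[OF _ TT, simplified]
  and J_cancel = involution_cancel[OF _ JJ, simplified]
  and U_cancel = involution_cancel[OF _ UU, simplified]

lemma inv_T: "inv T = T" and inv_J: "inv J = J" and inv_U: "inv U = U"
  by (simp_all add: involution_inv TT JJ UU)

lemma JTJ: "J \<otimes> T \<otimes> J = T \<otimes> J \<otimes> T"
  by (rule braid_involutions) (simp_all add: TT JJ JT3)

lemma UJU: "U \<otimes> J \<otimes> U = J \<otimes> U \<otimes> J"
  by (rule braid_involutions) (simp_all add: UU JJ UJ3)

lemma UTU: "U \<otimes> T \<otimes> U = T"
proof -
  have "(U \<otimes> T \<otimes> U) \<otimes> T = \<one>"
    using UT2 by (simp add: numeral_2_eq_2 m_assoc)
  then have "U \<otimes> T \<otimes> U = inv T"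
    by (simp add: inv_equality)
  then show ?thesis by (simp add: inv_T)
qed

lemma UaU: "U \<otimes> a \<otimes> U = c"
  using aU by (simp add: conjugate_def inv_U c_def)

lemma UcU: "U \<otimes> c \<otimes> U = a"
  by (simp add: UU U_cancel m_assoc flip: UaU)

lemma JaJ: "J \<otimes> a \<otimes> J = c \<otimes> a"
  by (simp add: c_def commutator_def inv_J m_assoc)

lemma JcJ: "J \<otimes> c \<otimes> J = inv c"
proof -
  have "(J \<otimes> c \<otimes> J) \<otimes> c = \<one>"
    using Jc2 by (simp add: numeral_2_eq_2 m_assoc flip: c_def)
  then show ?thesis by (simp add: inv_equality)
qed

section \<open>The quaternion group generated by \<open>a\<close> and \<open>c\<close>\<close>

lemma cc: "c \<otimes> c = a \<otimes> a"
  using a2 by (simp add: numeral_2_eq_2 flip: c_def)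

lemma a4: "a \<otimes> (a \<otimes> (a \<otimes> a)) = \<one>"
proof -
  have "(c \<otimes> c) \<otimes> (c \<otimes> c) = \<one>"
    using c4 by (simp add: numeral_eq_Suc m_assoc flip: c_def)
  then show ?thesis
    unfolding cc by (simp add: m_assoc)
qed

lemma inv_c: "inv c = a \<otimes> (a \<otimes> c)"
proof (rule inv_equality)
  show "a \<otimes> (a \<otimes> c) \<otimes> c = \<one>"
    by (simp add: m_assoc cc a4)
qed simp_all

lemma inv_a: "inv a = a \<otimes> (a \<otimes> a)"
  by (rule inv_equality) (simp_all add: m_assoc a4)

text \<open>Conjugating a^2 = c^2 by J gives (ca)^2 = c^-2 = a^2 = c^2. Cancelling yields aca = c,
  that is ca = a^-1 c, and a^-1 = a^3.\<close>

lemma ca: "c \<otimes> a = a \<otimes> (a \<otimes> (a \<otimes> c))"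
proof -
  have "(c \<otimes> a) \<otimes> (c \<otimes> a) = J \<otimes> (a \<otimes> a) \<otimes> J"
    unfolding JaJ[symmetric] by (simp add: m_assoc J_cancel)
  also have "\<dots> = (J \<otimes> c \<otimes> J) \<otimes> (J \<otimes> c \<otimes> J)"
    unfolding cc[symmetric] by (simp add: m_assoc J_cancel)
  also have "\<dots> = inv (c \<otimes> c)"
    unfolding JcJ by (simp add: inv_mult_group)
  also have "\<dots> = a \<otimes> a"
    unfolding cc by (rule inv_equality) (simp_all add: m_assoc a4)
  finally have "c \<otimes> (a \<otimes> (c \<otimes> a)) = c \<otimes> c"
    by (simp add: m_assoc cc)
  then have *: "a \<otimes> (c \<otimes> a) = c"
    by simp
  have "c \<otimes> a = inv a \<otimes> (a \<otimes> (c \<otimes> a))"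
    by (simp flip: m_assoc)
  also have "\<dots> = a \<otimes> (a \<otimes> (a \<otimes> c))"
    unfolding * by (simp add: inv_a m_assoc)
  finally show ?thesis .
qed

lemma cc_assoc: "w \<in> carrier G \<Longrightarrow> c \<otimes> (c \<otimes> w) = a \<otimes> (a \<otimes> w)"
  using mult_assoc_rule[OF cc] by (simp add: m_assoc)

lemma ca_assoc: "w \<in> carrier G \<Longrightarrow> c \<otimes> (a \<otimes> w) = a \<otimes> (a \<otimes> (a \<otimes> (c \<otimes> w)))"
  using mult_assoc_rule[OF ca] by (simp add: m_assoc)

lemma a4_assoc: "w \<in> carrier G \<Longrightarrow> a \<otimes> (a \<otimes> (a \<otimes> (a \<otimes> w))) = w"
  using mult_assoc_rule[OF a4] by (simp add: m_assoc)

text \<open>A complete rewriting system for the quaternion group, with normal forms \<open>a\<^sup>i c\<^sup>j\<close>,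
  \<open>i < 4\<close>, \<open>j < 2\<close>.\<close>

lemmas quaternion_simps = m_assoc cc cc_assoc ca ca_assoc a4 a4_assoc

text \<open>The normal forms are not claimed to be distinct; in an arbitrary model of the relations
  they may coincide.\<close>

definition quaternions where
  "quaternions = {\<one>, a, a \<otimes> a, a \<otimes> (a \<otimes> a), c, a \<otimes> c, a \<otimes> (a \<otimes> c), a \<otimes> (a \<otimes> (a \<otimes> c))}"

lemma quaternions_subgroup: "subgroup quaternions G"
proof (rule subgroupI)
  show "quaternions \<subseteq> carrier G" "quaternions \<noteq> {}"
    by (simp_all add: quaternions_def)
  show "x \<otimes> y \<in> quaternions" if "x \<in> quaternions" "y \<in> quaternions" for x y
    using that unfolding quaternions_def by (elim insertE emptyE; simp add: quaternion_simps)
  show "inv x \<in> quaternions" if "x \<in> quaternions" for x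
    using that unfolding quaternions_def
    by (elim insertE emptyE; simp add: inv_mult_group inv_a inv_c quaternion_simps)
qed

interpretation Q: subgroup quaternions G
  by (rule quaternions_subgroup)

lemma quaternions_mem [simp]: "a \<in> quaternions" "c \<in> quaternions"
  unfolding quaternions_def by blast+

text \<open>Since t^2 = 1, conjugation by t is multiplicative, so its values at \<open>a\<close> and
  \<open>c\<close> decide.\<close>

lemma quaternions_normalised:
  assumes t: "t \<in> carrier G" "t \<otimes> t = \<one>"
    and "t \<otimes> a \<otimes> t \<in> quaternions" "t \<otimes> c \<otimes> t \<in> quaternions" "q \<in> quaternions"
  shows "t \<otimes> q \<otimes> t \<in> quaternions"
proof -
  have mult: "t \<otimes> (x \<otimes> y) \<otimes> t \<in> quaternions"
    if "t \<otimes> x \<otimes> t \<in> quaternions" "t \<otimes> y \<otimes> t \<in> quaternions" "x \<in> carrier G" "y \<in> carrier G" for x y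
  proof -
    have "t \<otimes> (x \<otimes> y) \<otimes> t = (t \<otimes> x \<otimes> t) \<otimes> (t \<otimes> y \<otimes> t)"
      using t that(3,4) by (simp add: m_assoc involution_cancel)
    then show ?thesis using that(1,2) by simp
  qed
  have "t \<otimes> \<one> \<otimes> t \<in> quaternions"
    using t by simp
  moreover have "q \<in> {\<one>, a, a \<otimes> a, a \<otimes> (a \<otimes> a), c, a \<otimes> c, a \<otimes> (a \<otimes> c), a \<otimes> (a \<otimes> (a \<otimes> c))}"
    using assms(5) unfolding quaternions_def .
  ultimately show ?thesis
    by (elim insertE emptyE) (simp_all add: mult assms(3,4))
qed

text \<open>The relation (aT)^2 = T^c reads aTaT = c^-1 T c; cancelling the first a exhibits TaT as
  an element of QTQ.\<close>

lemma TaT: "T \<otimes> a \<otimes> T = inv a \<otimes> inv c \<otimes> T \<otimes> c"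
proof -
  have "a \<otimes> (T \<otimes> a \<otimes> T) = inv c \<otimes> T \<otimes> c"
    using aT2 by (simp add: numeral_2_eq_2 conjugate_def c_def m_assoc)
  then have "inv a \<otimes> (a \<otimes> (T \<otimes> a \<otimes> T)) = inv a \<otimes> (inv c \<otimes> T \<otimes> c)"
    by simp
  then show ?thesis
    by (simp flip: m_assoc)
qed

text \<open>Since \<open>U\<close> commutes with \<open>T\<close> and exchanges \<open>a\<close> and \<open>c\<close>, it exchanges the next relation with the
  previous one.\<close>

lemma TcT: "T \<otimes> c \<otimes> T = inv c \<otimes> inv a \<otimes> T \<otimes> a"
proof -
  have conj_mult: "U \<otimes> (x \<otimes> y) \<otimes> U = (U \<otimes> x \<otimes> U) \<otimes> (U \<otimes> y \<otimes> U)"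
    if "x \<in> carrier G" "y \<in> carrier G" for x y
    using that by (simp add: m_assoc U_cancel)
  have "U \<otimes> inv x \<otimes> U = inv (U \<otimes> x \<otimes> U)" if "x \<in> carrier G" for x
    using that by (simp add: inv_mult_group inv_U m_assoc)
  then show ?thesis
    using arg_cong[OF TaT, of "\<lambda>x. U \<otimes> x \<otimes> U"]
    by (simp add: conj_mult UTU UaU UcU del: m_assoc)
qed

text \<open>As a^4 = 1, the element a^2 is its own inverse, and (Ta^2)^3 = 1 becomes a braid
  relation.\<close>

lemma Ta2T: "T \<otimes> (a \<otimes> a) \<otimes> T = (a \<otimes> a) \<otimes> T \<otimes> (a \<otimes> a)"
proof -
  have "(T \<otimes> (a \<otimes> a)) [^] (3::nat) = \<one>"
    using Ta3 by (simp add: numeral_2_eq_2)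
  then show ?thesis
    by (intro braid_involutions) (simp_all add: TT quaternion_simps)
qed

section \<open>The chain of subgroups, named after their action on the eleven points\<close>

abbreviation affine where "affine \<equiv> double_coset_union G quaternions T"
abbreviation point_stabilizer where "point_stabilizer \<equiv> double_coset_union G affine J"
abbreviation whole where "whole \<equiv> double_coset_union G point_stabilizer U"

text \<open>All eight conjugates TqT must be placed in Q or QTQ. The rules for a, c and a^2 are at
  hand; inversion gives those for a^-1 and c^-1, a product gives ca, and a further inversion gives
  ac.\<close>

lemma affine_subgroup: "subgroup affine G"
proof (rule double_coset_union_subgroup[OF quaternions_subgroup])
  have mem: "x \<otimes> T \<otimes> y \<in> affine" if "x \<in> quaternions" "y \<in> quaternions" for x y
    using that by (rule double_coset_union_mem)
  have inv_conj: "T \<otimes> inv x \<otimes> T = inv (T \<otimes> x \<otimes> T)" if "x \<in> carrier G" for x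
    using that by (simp add: inv_mult_group inv_T m_assoc)
  have 1: "T \<otimes> \<one> \<otimes> T \<in> affine"
    by (simp add: TT double_coset_union_base)
  have 2: "T \<otimes> a \<otimes> T \<in> affine"
    unfolding TaT by (intro mem) simp_all
  have 3: "T \<otimes> (a \<otimes> a) \<otimes> T \<in> affine"
    unfolding Ta2T by (intro mem) simp_all
  have "T \<otimes> inv a \<otimes> T = inv c \<otimes> T \<otimes> (c \<otimes> a)"
    unfolding inv_conj[OF gens_closed(1)] TaT by (simp add: inv_mult_group inv_T m_assoc)
  then have 4: "T \<otimes> inv a \<otimes> T \<in> affine"
    using mem by simp
  have 5: "T \<otimes> c \<otimes> T \<in> affine"
    unfolding TcT by (intro mem) simp_all
  have Tc'T: "T \<otimes> inv c \<otimes> T = inv a \<otimes> T \<otimes> (a \<otimes> c)"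
    unfolding inv_conj[OF gens_closed(5)] TcT by (simp add: inv_mult_group inv_T m_assoc)
  then have 6: "T \<otimes> inv c \<otimes> T \<in> affine"
    using mem by simp
  have "T \<otimes> (c \<otimes> a) \<otimes> T = (T \<otimes> c \<otimes> T) \<otimes> (T \<otimes> a \<otimes> T)"
    by (simp add: m_assoc T_cancel)
  \<comment> \<open>Where the two conjugates meet, a cancels against a^-1, which leaves the single
    conjugate T c^-1 T, already known.\<close>
  also have "\<dots> = inv c \<otimes> inv a \<otimes> (T \<otimes> inv c \<otimes> T) \<otimes> c"
    unfolding TaT TcT by (simp add: m_assoc flip: m_assoc[of a "inv a"])
  finally have TcaT: "T \<otimes> (c \<otimes> a) \<otimes> T = inv c \<otimes> inv a \<otimes> inv a \<otimes> T \<otimes> (a \<otimes> c \<otimes> c)"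
    unfolding Tc'T by (simp add: m_assoc)
  then have 7: "T \<otimes> (c \<otimes> a) \<otimes> T \<in> affine"
    using mem by simp
  \<comment> \<open>In the quaternion group ac is the inverse of ca.\<close>
  have "T \<otimes> (a \<otimes> c) \<otimes> T = inv (T \<otimes> (c \<otimes> a) \<otimes> T)"
    by (simp add: inv_mult_group inv_T inv_a inv_c quaternion_simps)
  also have "\<dots> = inv (a \<otimes> c \<otimes> c) \<otimes> T \<otimes> (a \<otimes> a \<otimes> c)"
    unfolding TcaT by (simp add: inv_mult_group inv_T m_assoc)
  finally have 8: "T \<otimes> (a \<otimes> c) \<otimes> T \<in> affine"
    using mem by simp
  show "T \<otimes> q \<otimes> T \<in> affine" if "q \<in> quaternions" for q
  proof -
    \<comment> \<open>The normal forms a^3, a^2 c and a^3 c are a^-1, c^-1 and ca.\<close>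
    have "q \<in> {\<one>, a, a \<otimes> a, inv a, c, inv c, c \<otimes> a, a \<otimes> c}"
      using that unfolding quaternions_def ca inv_a inv_c by blast
    then show ?thesis
      by (elim insertE emptyE) (simp_all only: 1 2 3 4 5 6 7 8)
  qed
qed (simp_all add: TT)

lemma J_normalises_quaternions:
  assumes "q \<in> quaternions"
  shows "J \<otimes> q \<otimes> J \<in> quaternions"
  by (rule quaternions_normalised) (simp_all add: JJ JaJ JcJ assms)

lemma U_normalises_quaternions:
  assumes "q \<in> quaternions"
  shows "U \<otimes> q \<otimes> U \<in> quaternions"
  by (rule quaternions_normalised) (simp_all add: UU UaU UcU assms)

lemma U_normalises_affine:
  assumes "x \<in> affine"
  shows "U \<otimes> x \<otimes> U \<in> affine"
proof -
  from assms show ?thesis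
  proof (cases rule: double_coset_union_cases)
    case 1
    then show ?thesis
      using U_normalises_quaternions by (simp add: double_coset_union_base)
  next
    case (2 p q)
    then have "U \<otimes> x \<otimes> U = (U \<otimes> p \<otimes> U) \<otimes> (U \<otimes> T \<otimes> U) \<otimes> (U \<otimes> q \<otimes> U)"
      by (simp add: m_assoc U_cancel)
    then show ?thesis
      using 2 U_normalises_quaternions unfolding UTU by (simp add: double_coset_union_mem)
  qed
qed

text \<open>The braid lemma is applied to Q with s = T and t = J; for \<open>whole\<close> it is
  applied one level higher, to \<open>affine\<close> with s = J and t = U.\<close>

lemma point_stabilizer_subgroup: "subgroup point_stabilizer G"
  by (rule double_coset_union_braid)
    (fact quaternions_subgroup affine_subgroup gens_closed JJ J_normalises_quaternions JTJ)+

lemma whole_subgroup: "subgroup whole G"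
  by (rule double_coset_union_braid)
    (fact affine_subgroup point_stabilizer_subgroup gens_closed UU U_normalises_affine UJU)+

text \<open>Together with \<open>whole_subgroup\<close> this makes \<open>whole\<close> the entire
  group as soon as the four elements generate it.\<close>

lemma generators_in_whole: "{a, T, J, U} \<subseteq> whole"
proof -
  have mem: "t \<in> double_coset_union G B t" if "subgroup B G" "t \<in> carrier G" for B t
    using double_coset_union_mem[of "\<one>" B "\<one>" G t] that by (simp add: subgroup.one_closed)
  have "a \<in> affine" "T \<in> affine" "J \<in> point_stabilizer" "U \<in> whole"
    using mem quaternions_subgroup affine_subgroup point_stabilizer_subgroup
    by (simp_all add: double_coset_union_base)
  then show ?thesis
    by (simp add: double_coset_union_base)
qed

end

section \<open>The permutations\<close>

locale field_of_order_nine =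
  fixes \<zeta> :: "'k::field"
  assumes card_nine: "CARD('k) = 9"
    and zeta: "\<zeta> ^ 2 = 1 - \<zeta>"
begin

section \<open>Arithmetic in the field of nine elements\<close>

lemma finite_field: "finite (UNIV :: 'k set)"
  using card_nine by (simp add: card_ge_0_finite)

text \<open>Translation by \<open>1\<close> permutes the field, so summing over all elements gives \<open>9 = 0\<close>.\<close>

lemma three_eq_zero: "(3::'k) = 0"
proof -
  have "(\<Sum>x\<in>UNIV. x + 1) = (\<Sum>x\<in>UNIV. x :: 'k)"
    by (rule sum.reindex_bij_betw) (rule bij_betw_byWitness[where f' = "\<lambda>x. x - 1"]; auto)
  then have "(of_nat CARD('k) :: 'k) = 0"
    by (simp add: sum.distrib)
  then have "(3::'k) * 3 = 0"
    by (simp add: card_nine)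
  then show ?thesis
    unfolding mult_eq_0_iff by blast
qed

lemma of_int_mod_three [simp]: "(of_int (n mod 3) :: 'k) = of_int n"
proof -
  have "(of_int n :: 'k) = of_int (3 * (n div 3) + n mod 3)" by simp
  also have "\<dots> = of_int (n mod 3)"
    unfolding of_int_add of_int_mult by (simp add: three_eq_zero)
  finally show ?thesis ..
qed

lemma mod_three_cases: "(n::int) mod 3 \<in> {0, 1, 2}"
  by auto

lemma two_eq_minus_one: "(2::'k) = -1"
proof -
  have "(2::'k) - (-1) = 3" by simp
  then show ?thesis
    using three_eq_zero eq_iff_diff_eq_0 by metis
qed

lemma two_neq_zero: "(2::'k) \<noteq> 0"
  by (simp add: two_eq_minus_one)

lemma one_neq_two: "(1::'k) \<noteq> 2"
proof
  assume "(1::'k) = 2"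
  then have "(1::'k) + 0 = 1 + 1" by simp
  then show False
    unfolding add_left_cancel by simp
qed

lemma of_int_cases: "(of_int n :: 'k) \<in> {0, 1, -1}"
proof -
  have "(of_int (n mod 3) :: 'k) \<in> {0, 1, -1}"
    using mod_three_cases[of n] two_eq_minus_one by (auto simp del: of_int_mod_three)
  then show ?thesis by simp
qed

lemma of_int_eq_0: "(of_int n :: 'k) = 0 \<longleftrightarrow> n mod 3 = 0"
proof -
  have "(of_int (n mod 3) :: 'k) = 0 \<longleftrightarrow> n mod 3 = 0"
    using mod_three_cases[of n] two_neq_zero by (auto simp del: of_int_mod_three)
  then show ?thesis by simp
qed

lemma of_int_cube: "(of_int n :: 'k) ^ 3 = of_int n"
  using of_int_cases[of n] by auto

lemma of_int_square: "of_int n \<noteq> (0::'k) \<Longrightarrow> (of_int n :: 'k) * of_int n = 1"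
  using of_int_cases[of n] by auto

section \<open>Coordinates with respect to the basis 1, \<zeta> over the prime field\<close>

lemma zeta_not_int: "\<zeta> \<noteq> of_int n"
proof
  assume "\<zeta> = of_int n"
  then have "\<zeta> \<in> {0, 1, -1}"
    using of_int_cases[of n] by simp
  \<comment> \<open>The three candidates would give 0 = 1, 1 = 0 and 1 = 2 respectively.\<close>
  then show False
    using zeta one_neq_two by auto
qed

text \<open>If j were nonzero in the field, then j^2 = 1 and \<zeta> = -ij would lie in the prime
  field.\<close>

lemma combination_eq_0:
  "of_int i + \<zeta> * of_int j = (0::'k) \<longleftrightarrow> of_int i = (0::'k) \<and> of_int j = (0::'k)"
proof -
  have False if "of_int i + \<zeta> * of_int j = (0::'k)" "of_int j \<noteq> (0::'k)"
  proof -
    have "\<zeta> = \<zeta> * of_int j * of_int j"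
      using of_int_square[OF that(2)] by (simp add: mult.assoc)
    also have "\<dots> = - of_int i * of_int j"
      using that(1) by (simp add: add_eq_0_iff)
    also have "\<dots> = of_int (- i * j)" by simp
    finally show False
      using zeta_not_int by blast
  qed
  then show ?thesis
    by (metis add.right_neutral mult_zero_right)
qed

text \<open>Integer coordinates turn later identities between permutations into computations with
  numerals modulo 3.\<close>

definition pt :: "int \<Rightarrow> int \<Rightarrow> 'k point" where
  "pt i j = Fin (of_int i + \<zeta> * of_int j)"

lemma pt_eq_iff: "pt i j = pt i' j' \<longleftrightarrow> i mod 3 = i' mod 3 \<and> j mod 3 = j' mod 3"
proof -
  have "pt i j = pt i' j' \<longleftrightarrow> of_int (i - i') + \<zeta> * of_int (j - j') = (0::'k)"
    by (simp add: pt_def algebra_simps flip: eq_iff_diff_eq_0)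
  then show ?thesis
    unfolding combination_eq_0 of_int_eq_0 by (simp add: mod_eq_dvd_iff mod_eq_0_iff_dvd)
qed

lemma pt_mod: "pt (i mod 3) (j mod 3) = pt i j"
  by (simp add: pt_eq_iff)

lemma pt_not [simp]: "pt i j \<noteq> Infty" "pt i j \<noteq> Extra" "Infty \<noteq> pt i j" "Extra \<noteq> pt i j"
  by (simp_all add: pt_def)

text \<open>Counting: the nine coordinate pairs give nine distinct elements, and the field has no
  more.\<close>

lemma pt_surj: "\<exists>i\<in>{0, 1, 2}. \<exists>j\<in>{0, 1, 2}. Fin x = pt i j"
proof -
  let ?S = "{0, 1, 2} \<times> {0, 1, 2} :: (int \<times> int) set"
  let ?f = "\<lambda>(i, j). of_int i + \<zeta> * of_int j"
  have "inj_on ?f ?S"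
  proof (rule inj_onI, clarify)
    fix i j i' j' :: int
    assume "of_int i + \<zeta> * of_int j = of_int i' + \<zeta> * of_int j'"
    then have "pt i j = pt i' j'"
      by (simp add: pt_def)
    moreover assume "i \<in> {0, 1, 2}" "j \<in> {0, 1, 2}" "i' \<in> {0, 1, 2}" "j' \<in> {0, 1, 2}"
    ultimately show "i = i' \<and> j = j'"
      unfolding pt_eq_iff by auto
  qed
  then have "card (?f ` ?S) = CARD('k)"
    by (simp add: card_image card_nine)
  then have "?f ` ?S = UNIV"
    by (intro card_subset_eq) (auto simp: finite_field)
  then obtain p where "p \<in> ?S" "x = ?f p"
    by blast
  then show ?thesis
    unfolding pt_def by (cases p) auto
qed

lemma point_cases:
  obtains i j where "p = pt i j" "i \<in> {0, 1, 2}" "j \<in> {0, 1, 2}" | "p = Infty" | "p = Extra"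
  using pt_surj by (cases p) blast+

section \<open>The generating permutations in coordinates\<close>

lemma zeta_mult: "\<zeta> * \<zeta> = 1 - \<zeta>"
  using zeta by (simp add: power2_eq_square)

lemma inverse_zeta: "inverse \<zeta> = 1 + \<zeta>"
  by (rule inverse_unique) (simp add: algebra_simps zeta_mult)

text \<open>The Frobenius identity: the mixed terms carry the factor 3 = 0.\<close>

lemma cube_add: "(x + y) ^ 3 = x ^ 3 + y ^ (3::nat)" for x y :: 'k
proof -
  have "(x + y) ^ 3 = x ^ 3 + y ^ 3 + 3 * (x * x * y + x * y * y)"
    by (simp add: power3_eq_cube algebra_simps)
  then show ?thesis by (simp add: three_eq_zero)
qed

text \<open>Cubing fixes the prime field, so the image is (1 + \<zeta>)i + \<zeta>^2 j with
  \<zeta>^2 = 1 - \<zeta>. Taking residues keeps the coordinates in {0, 1, 2} under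
  iteration.\<close>

lemma perm_a_pt: "perm_a \<zeta> (pt i j) = pt ((i + j) mod 3) ((i - j) mod 3)"
proof -
  have "inverse \<zeta> * (of_int i + \<zeta> * of_int j) ^ 3
      = inverse \<zeta> * of_int i + inverse \<zeta> * \<zeta> * (\<zeta> * \<zeta>) * of_int j"
    unfolding cube_add power_mult_distrib of_int_cube by (simp add: power3_eq_cube algebra_simps)
  also have "\<dots> = of_int (i + j) + \<zeta> * of_int (i - j)"
    by (simp add: inverse_zeta zeta_mult algebra_simps) 
  finally show ?thesis
    by (simp add: pt_mod perm_a_def) (simp add: pt_def)
qed

lemma perm_T_pt: "perm_T (pt i j) = pt ((1 - i) mod 3) (- j mod 3)"
  by (simp add: pt_mod perm_T_def) (simp add: pt_def algebra_simps)

text \<open>The inverse of \<open>\<alpha> + \<zeta>\<beta>\<close> is its conjugate \<open>\<alpha> - \<beta> - \<zeta>\<beta>\<close> divided by its norm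
  \<open>\<alpha>\<^sup>2 - \<alpha>\<beta> - \<beta>\<^sup>2\<close>, which is \<open>1\<close> or \<open>-1\<close>.\<close>

lemma perm_J_pt:
  "perm_J (pt i j) = (if i mod 3 = 0 \<and> j mod 3 = 0 then Infty
     else pt ((i * i - i * j - j * j) * (i - j) mod 3) (- ((i * i - i * j - j * j) * j) mod 3))"
proof (cases "i mod 3 = 0 \<and> j mod 3 = 0")
  case True
  then show ?thesis
    by (simp add: perm_J_def pt_def combination_eq_0 of_int_eq_0)
next
  case False
  define N where "N = i * i - i * j - j * j"
  define x where "x = of_int i + \<zeta> * (of_int j :: 'k)"
  define y where "y = of_int (i - j) - \<zeta> * (of_int j :: 'k)"
  have x: "x \<noteq> 0"
    using False by (simp add: x_def combination_eq_0 of_int_eq_0)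
  have y: "y \<noteq> 0"
  proof
    assume "y = 0"
    then have "of_int (i - j) + \<zeta> * of_int (- j) = (0::'k)"
      by (simp add: y_def)
    then have "(i - j) mod 3 = 0 \<and> - j mod 3 = 0"
      unfolding combination_eq_0 of_int_eq_0 .
    then show False
      using False by presburger
  qed
  have "x * y = of_int i * of_int i - of_int i * of_int j - \<zeta> * of_int j * of_int j
      - \<zeta> * \<zeta> * of_int j * of_int j"
    by (simp add: x_def y_def algebra_simps)
  also have "\<dots> = of_int N"
    unfolding zeta_mult N_def by (simp add: algebra_simps)
  finally have xy: "x * y = of_int N" .
  have "x * y \<noteq> 0"
    using x y by simp
  then have N: "of_int N \<noteq> (0::'k)"
    unfolding xy .
  have "x * (of_int N * y) = of_int N * (x * y)"
    by (rule mult.left_commute)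
  also have "\<dots> = 1"
    unfolding xy by (rule of_int_square[OF N])
  finally have "x * (of_int N * y) = 1" .
  then have "inverse x = of_int N * y"
    by (rule inverse_unique)
  also have "\<dots> = of_int (N * (i - j)) + \<zeta> * of_int (- (N * j))"
    by (simp add: y_def algebra_simps)
  finally have "perm_J (Fin x) = pt (N * (i - j)) (- (N * j))"
    using x by (simp add: perm_J_def pt_def)
  moreover have "pt i j = Fin x"
    by (simp add: pt_def x_def)
  ultimately show ?thesis
    unfolding if_not_P[OF False] pt_mod N_def by simp
qed

text \<open>The description under \<open>THE\<close> is unambiguous: equal elements have coordinates
  congruent modulo 3, and negating the second coordinate respects congruence.\<close>

lemma perm_U_pt: "perm_U \<zeta> (pt i j) = pt i (- j mod 3)"
proof -
  let ?P = "\<lambda>\<omega>'. \<exists>\<alpha>\<in>prime_subfield. \<exists>\<beta>\<in>prime_subfield.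
      of_int i + \<zeta> * of_int j = \<alpha> + \<zeta> * \<beta> \<and> \<omega>' = \<alpha> - \<zeta> * \<beta>"
  have "(THE \<omega>'. ?P \<omega>') = of_int i - \<zeta> * of_int j"
  proof (rule the_equality)
    show "?P (of_int i - \<zeta> * of_int j)"
      unfolding prime_subfield_def by blast
    fix \<omega>' assume "?P \<omega>'"
    then obtain k l where kl: "of_int i + \<zeta> * of_int j = (of_int k + \<zeta> * of_int l :: 'k)"
        and \<omega>': "\<omega>' = of_int k - \<zeta> * of_int l"
      unfolding prime_subfield_def by blast
    have "pt i j = pt k l"
      using kl by (simp add: pt_def)
    then have "pt i (- j) = pt k (- l)"
      by (auto simp: pt_eq_iff intro: mod_minus_cong)
    then show "\<omega>' = of_int i - \<zeta> * of_int j"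
      by (simp add: pt_def \<omega>')
  qed
  then have "perm_U \<zeta> (pt i j) = pt i (- j)"
    by (simp add: perm_U_def pt_def)
  then show ?thesis
    by (simp add: pt_eq_iff)
qed

lemma perm_Infty_Extra:
  "perm_a \<zeta> Infty = Infty" "perm_a \<zeta> Extra = Extra"
  "perm_T Infty = Infty" "perm_T Extra = Extra"
  "perm_J Infty = pt 0 0" "perm_J Extra = Extra"
  "perm_U \<zeta> Infty = Extra" "perm_U \<zeta> Extra = Infty"
  by (simp_all add: perm_a_def perm_T_def perm_J_def perm_U_def pt_def)

lemmas perm_simps = perm_a_pt perm_T_pt perm_J_pt perm_U_pt perm_Infty_Extra

text \<open>Reduces an identity between maps to eleven evaluations that simplification can
  settle.\<close>

lemma perm_eqI:
  assumes "f (pt 0 0) = g (pt 0 0)" "f (pt 0 1) = g (pt 0 1)" "f (pt 0 2) = g (pt 0 2)"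
    and "f (pt 1 0) = g (pt 1 0)" "f (pt 1 1) = g (pt 1 1)" "f (pt 1 2) = g (pt 1 2)"
    and "f (pt 2 0) = g (pt 2 0)" "f (pt 2 1) = g (pt 2 1)" "f (pt 2 2) = g (pt 2 2)"
    and "f Infty = g Infty" "f Extra = g Extra"
  shows "f = g"
proof
  show "f p = g p" for p
    using assms by (cases p rule: point_cases) auto
qed

lemma perm_a_order: "perm_a \<zeta> \<circ> perm_a \<zeta> \<circ> perm_a \<zeta> \<circ> perm_a \<zeta> = id"
  and perm_T_order: "perm_T \<circ> perm_T = (id :: 'k point \<Rightarrow> 'k point)"
  and perm_J_order: "perm_J \<circ> perm_J = (id :: 'k point \<Rightarrow> 'k point)"
  and perm_U_order: "perm_U \<zeta> \<circ> perm_U \<zeta> = id"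
  by (rule perm_eqI; simp add: perm_simps)+

end

section \<open>The symmetric group on a whole type\<close>

lemma carrier_BijGroup_UNIV: "f \<in> carrier (BijGroup UNIV) \<longleftrightarrow> bij f"
  by (simp add: BijGroup_def Bij_def)

text \<open>The operation of \<open>BijGroup\<close> is restricted to bijections, hence the
  membership hypotheses; restricting functions to \<open>UNIV\<close> changes nothing.\<close>

lemma mult_BijGroup_UNIV:
  "f \<in> carrier (BijGroup UNIV) \<Longrightarrow> g \<in> carrier (BijGroup UNIV) \<Longrightarrow> f \<otimes>\<^bsub>BijGroup UNIV\<^esub> g = f \<circ> g"
  by (simp add: BijGroup_def compose_def fun_eq_iff)

lemma one_BijGroup_UNIV: "\<one>\<^bsub>BijGroup UNIV\<^esub> = id"
  by (simp add: BijGroup_def fun_eq_iff)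

lemma nat_pow_BijGroup_UNIV:
  assumes "f \<in> carrier (BijGroup UNIV)"
  shows "f [^]\<^bsub>BijGroup UNIV\<^esub> (n::nat) = f ^^ n"
proof -
  interpret group "BijGroup UNIV" by (rule group_BijGroup)
  show ?thesis
    by (induction n)
      (use assms in \<open>simp_all add: one_BijGroup_UNIV mult_BijGroup_UNIV funpow_swap1 fun_eq_iff\<close>)
qed

lemma inv_BijGroup_UNIV:
  assumes "f \<in> carrier (BijGroup UNIV)" "g \<in> carrier (BijGroup UNIV)" "g \<circ> f = id"
  shows "inv\<^bsub>BijGroup UNIV\<^esub> f = g"
  using assms
  by (intro group.inv_equality[OF group_BijGroup]) (simp_all add: mult_BijGroup_UNIV one_BijGroup_UNIV)

section \<open>The relations hold for the permutations\<close>

context field_of_order_nine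
begin

abbreviation PG :: "('k point \<Rightarrow> 'k point) monoid" where
  "PG \<equiv> BijGroup UNIV"

lemma perms_in_BijGroup:
  "perm_a \<zeta> \<in> carrier PG" "perm_T \<in> carrier PG" "perm_J \<in> carrier PG" "perm_U \<zeta> \<in> carrier PG"
  unfolding carrier_BijGroup_UNIV using perm_a_order perm_T_order perm_J_order perm_U_order
  by (auto intro!: o_bij simp: comp_assoc)

text \<open>The commutator with J^-1 = J and a^-1 = a^3 inserted, so that it can be evaluated
  pointwise.\<close>

definition perm_c :: "'k point \<Rightarrow> 'k point" where
  "perm_c = perm_J \<circ> perm_a \<zeta> \<circ> perm_J \<circ> (perm_a \<zeta> \<circ> perm_a \<zeta> \<circ> perm_a \<zeta>)"

lemma commutator_perm: "commutator PG perm_J (perm_a \<zeta>) = perm_c"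
proof -
  interpret group PG by (rule group_BijGroup)
  note cl = perms_in_BijGroup
  have "inv\<^bsub>PG\<^esub> perm_J = perm_J"
    by (rule inv_BijGroup_UNIV[OF cl(3) cl(3) perm_J_order])
  moreover have aaa: "perm_a \<zeta> \<circ> perm_a \<zeta> \<circ> perm_a \<zeta> \<in> carrier PG"
    using perms_in_BijGroup(1) unfolding carrier_BijGroup_UNIV by (intro bij_comp)
  moreover have "inv\<^bsub>PG\<^esub> (perm_a \<zeta>) = perm_a \<zeta> \<circ> perm_a \<zeta> \<circ> perm_a \<zeta>"
    by (rule inv_BijGroup_UNIV[OF cl(1) aaa perm_a_order])
  ultimately show ?thesis
    using cl m_closed[OF cl(3) cl(1)] m_closed[OF m_closed[OF cl(3) cl(1)] cl(3)]
    unfolding commutator_def perm_c_def by (simp only: mult_BijGroup_UNIV)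
qed

lemma perm_c_closed: "perm_c \<in> carrier PG"
  using perms_in_BijGroup unfolding perm_c_def carrier_BijGroup_UNIV by (simp add: bij_comp)

text \<open>In coordinates this is multiplication by \<zeta>^2 = 1 - \<zeta>: JaJ sends \<omega> to
  \<zeta>\<omega>^3, and a^-1, applied first, undoes the cubing and contributes another \<zeta>. The
  proof evaluates the nine representatives, hence the bounds on i and j.\<close>

lemma perm_c_pt:
  assumes "i \<in> {0, 1, 2}" "j \<in> {0, 1, 2}"
  shows "perm_c (pt i j) = pt ((i - j) mod 3) ((- i - j) mod 3)"
  using assms by (elim insertE emptyE; simp add: perm_c_def perm_simps)

lemma perm_c_Infty_Extra: "perm_c Infty = Infty" "perm_c Extra = Extra"
  by (simp_all add: perm_c_def perm_simps)

lemmas all_perm_simps = perm_simps perm_c_pt perm_c_Infty_Extra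

lemma perm_c_order: "(perm_c \<circ> perm_c \<circ> perm_c) \<circ> perm_c = id"
  by (rule perm_eqI; simp add: all_perm_simps)

lemma m11_group_perms: "m11_group PG (perm_a \<zeta>) perm_T perm_J (perm_U \<zeta>)"
proof -
  interpret group PG by (rule group_BijGroup)
  note cl = perms_in_BijGroup perm_c_closed
  have comp_closed: "f \<circ> g \<in> carrier PG" if "f \<in> carrier PG" "g \<in> carrier PG" for f g :: "'k point \<Rightarrow> 'k point"
    using that unfolding carrier_BijGroup_UNIV by (rule bij_comp[rotated])
  have funpow_closed: "f ^^ n \<in> carrier PG" if "f \<in> carrier PG" for f :: "'k point \<Rightarrow> 'k point" and n
    using that unfolding carrier_BijGroup_UNIV by (rule bij_fn)
  have inv_U: "inv\<^bsub>PG\<^esub> (perm_U \<zeta>) = perm_U \<zeta>"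
    by (rule inv_BijGroup_UNIV[OF cl(4) cl(4) perm_U_order])
  have inv_c: "inv\<^bsub>PG\<^esub> perm_c = perm_c \<circ> perm_c \<circ> perm_c"
    by (rule inv_BijGroup_UNIV[OF cl(5) comp_closed[OF comp_closed[OF cl(5) cl(5)] cl(5)] perm_c_order])
  note to_composition = commutator_perm conjugate_def inv_U inv_c cl mult_BijGroup_UNIV
    comp_closed funpow_closed nat_pow_BijGroup_UNIV one_BijGroup_UNIV
  show ?thesis
  proof (unfold_locales, goal_cases)
    \<comment> \<open>Goals 5 to 16 are the twelve relations; the others say that the four
      permutations lie in the group.\<close>
    case 5 show ?case
      by (simp only: to_composition, rule perm_eqI; simp add: numeral_eq_Suc all_perm_simps)
  next
    case 6 show ?case
      by (simp only: to_composition, rule perm_eqI; simp add: numeral_eq_Suc all_perm_simps)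
  next
    case 7 show ?case
      by (simp only: to_composition, rule perm_eqI; simp add: numeral_eq_Suc all_perm_simps)
  next
    case 8 show ?case
      by (simp only: to_composition, rule perm_eqI; simp add: numeral_eq_Suc all_perm_simps)
  next
    case 9 show ?case
      by (simp only: to_composition, rule perm_eqI; simp add: numeral_eq_Suc all_perm_simps)
  next
    case 10 show ?case
      by (simp only: to_composition, rule perm_eqI; simp add: numeral_eq_Suc all_perm_simps)
  next
    case 11 show ?case
      by (simp only: to_composition, rule perm_eqI; simp add: numeral_eq_Suc all_perm_simps)
  next
    case 12 show ?case
      by (simp only: to_composition, rule perm_eqI; simp add: numeral_eq_Suc all_perm_simps)
  next
    case 13 show ?case
      by (simp only: to_composition, rule perm_eqI; simp add: numeral_eq_Suc all_perm_simps)
  next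
    case 14 show ?case
      by (simp only: to_composition, rule perm_eqI; simp add: numeral_eq_Suc all_perm_simps)
  next
    case 15 show ?case
      by (simp only: to_composition, rule perm_eqI; simp add: numeral_eq_Suc all_perm_simps)
  next
    case 16 show ?case
      by (simp only: to_composition, rule perm_eqI; simp add: numeral_eq_Suc all_perm_simps)
  qed (simp_all only: cl)
qed

end

section \<open>The action on the eleven points and its faithfulness\<close>

locale m11_action = m11_group G a T J U + field_of_order_nine \<zeta>
  for G (structure) and a T J U and \<zeta> :: "'k::field" +
  fixes h :: "'a \<Rightarrow> 'k point \<Rightarrow> 'k point"
  assumes hom: "h \<in> hom G (BijGroup UNIV)"
    and h_gens: "h a = perm_a \<zeta>" "h T = perm_T" "h J = perm_J" "h U = perm_U \<zeta>"
    and generated: "carrier G = generate G {a, T, J, U}"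
begin

sublocale action: group_hom G "BijGroup UNIV" h
  using hom group_BijGroup by (intro group_hom.intro group_hom_axioms.intro is_group)

lemma action_mult: "x \<in> carrier G \<Longrightarrow> y \<in> carrier G \<Longrightarrow> h (x \<otimes> y) p = h x (h y p)"
  by (simp add: mult_BijGroup_UNIV)

lemma action_inj: "x \<in> carrier G \<Longrightarrow> h x p = h x q \<Longrightarrow> p = q"
  using action.hom_closed[of x] unfolding carrier_BijGroup_UNIV by (metis bij_pointE)

lemma double_coset_fixes:
  assumes "B \<subseteq> carrier G" "t \<in> carrier G" "\<And>b. b \<in> B \<Longrightarrow> h b p = p" "h t p = p"
    and "d \<in> double_coset_union G B t"
  shows "h d p = p"
  using assms(5)
proof (cases rule: double_coset_union_cases)
  case 1
  then show ?thesis by (rule assms(3))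
next
  case (2 x y)
  then have "x \<in> carrier G" "y \<in> carrier G"
    using assms(1) by blast+
  then show ?thesis
    unfolding 2(1) using 2(2,3) assms(2-4) by (simp add: action_mult del: action.hom_mult)
qed

text \<open>If xty fixes p, then x(tp) = p = xp because x and y fix p. Injectivity of x gives tp =
  p, contrary to assumption.\<close>

lemma double_coset_fixing_mem:
  assumes "d \<in> double_coset_union G B t"
    and "B \<subseteq> carrier G" "t \<in> carrier G" "\<And>b. b \<in> B \<Longrightarrow> h b p = p" "h t p \<noteq> p" "h d p = p"
  shows "d \<in> B"
  using assms(1)
proof (cases rule: double_coset_union_cases)
  case (2 x y)
  then have xy: "x \<in> carrier G" "y \<in> carrier G"
    using assms(2) by blast+
  have "h x (h t (h y p)) = p"
    using assms(3,6) xy unfolding 2(1) by (simp add: action_mult del: action.hom_mult)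
  then have "h x (h t p) = h x p"
    using 2(2,3) assms(4) by simp
  then show ?thesis
    using action_inj[OF xy(1)] assms(5) by blast
qed

lemma h_c: "h c = perm_c"
  unfolding c_def commutator_perm[symmetric] by (simp add: commutator_def h_gens)

text \<open>The eight normal forms are evaluated one by one; all but the first move
  \<open>pt 1 0\<close>.\<close>

lemma quaternions_action:
  assumes "q \<in> quaternions"
  shows "h q (pt 0 0) = pt 0 0" "h q Infty = Infty" "h q Extra = Extra"
    and "h q (pt 1 0) = pt 1 0 \<Longrightarrow> q = \<one>"
  using assms unfolding quaternions_def
  by (elim insertE emptyE;
      simp add: action_mult one_BijGroup_UNIV h_gens h_c all_perm_simps pt_eq_iff del: action.hom_mult)+

lemma action_faithful:
  assumes "x \<in> carrier G" "h x = id"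
  shows "x = \<one>"
proof -
  have Q: "quaternions \<subseteq> carrier G" and B: "affine \<subseteq> carrier G"
    and H: "point_stabilizer \<subseteq> carrier G"
    by (rule subgroup.subset quaternions_subgroup affine_subgroup point_stabilizer_subgroup)+
  note T = double_coset_fixes[OF Q gens_closed(2)]
  have B_Infty: "h b Infty = Infty" and B_Extra: "h b Extra = Extra" if "b \<in> affine" for b
    using T[OF quaternions_action(2) _ that] T[OF quaternions_action(3) _ that]
    by (simp_all add: h_gens perm_simps)
  have H_Extra: "h b Extra = Extra" if "b \<in> point_stabilizer" for b
    using double_coset_fixes[OF B gens_closed(3) B_Extra _ that]
    by (simp add: h_gens perm_simps)
  have "carrier G \<subseteq> whole"
    unfolding generated by (rule generate_subgroup_incl[OF generators_in_whole whole_subgroup])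
  then have "x \<in> whole"
    using assms by blast
  \<comment> \<open>Descent along the chain: U moves \<open>Extra\<close>, J moves
    \<open>Infty\<close> and T moves \<open>pt 0 0\<close>, so each step excludes one double
    coset.\<close>
  then have "x \<in> point_stabilizer"
    by (rule double_coset_fixing_mem[OF _ H gens_closed(4) H_Extra])
      (simp_all add: h_gens perm_simps assms(2))
  then have "x \<in> affine"
    by (rule double_coset_fixing_mem[OF _ B gens_closed(3) B_Infty])
      (simp_all add: h_gens perm_simps assms(2))
  then have "x \<in> quaternions"
    by (rule double_coset_fixing_mem[OF _ Q gens_closed(2) quaternions_action(1)])
      (simp_all add: h_gens perm_simps assms(2) pt_eq_iff)
  then show ?thesis
    by (rule quaternions_action(4)) (simp add: assms(2))
qed

lemma action_iso: "h \<in> iso G (M11 \<zeta>)"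
proof -
  have "inj_on h (carrier G)"
    using action_faithful action.inj_iff_trivial_ker
    by (auto simp: kernel_def one_BijGroup_UNIV[symmetric])
  moreover have "h ` carrier G = carrier (M11 \<zeta>)"
    unfolding generated using action.generate_img[of "{a, T, J, U}"] by (simp add: M11_def h_gens)
  \<comment> \<open>\<open>M11\<close> inherits its operation from the symmetric group, so only the
    target carrier has to be adjusted.\<close>
  moreover from this have "h \<in> hom G (M11 \<zeta>)"
    using hom by (auto simp: hom_def M11_def)
  ultimately show ?thesis
    by (simp add: iso_def bij_betw_def)
qed

end

section \<open>The presentation\<close>

lemma (in group_hom) hom_commutator:
  "x \<in> carrier G \<Longrightarrow> y \<in> carrier G \<Longrightarrow> h (commutator G x y) = commutator H (h x) (h y)"
  by (simp add: commutator_def)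

lemma (in group_hom) hom_conjugate:
  "x \<in> carrier G \<Longrightarrow> y \<in> carrier G \<Longrightarrow> h (conjugate G x y) = conjugate H (h x) (h y)"
  by (simp add: conjugate_def)

lemma (in group) commutator_closed:
  "x \<in> carrier G \<Longrightarrow> y \<in> carrier G \<Longrightarrow> commutator G x y \<in> carrier G"
  by (simp add: commutator_def)

lemma (in group) conjugate_closed:
  "x \<in> carrier G \<Longrightarrow> y \<in> carrier G \<Longrightarrow> conjugate G x y \<in> carrier G"
  by (simp add: conjugate_def)

interpretation m11: free_group_relations m11_relations
proof
  interpret F: group "free_group :: m11_symbol word set monoid"
    by (rule group_free_group)
  show "x \<in> carrier free_group \<and> y \<in> carrier free_group" if "(x, y) \<in> m11_relations" for x y
    using that unfolding m11_relations_def Let_def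
    by (elim insertE emptyE) (simp_all add: F.commutator_closed F.conjugate_closed)
qed

text \<open>Used in both directions: for the quotient map it yields the relations in the presented
  group, and for evaluation at the permutations it shows that this evaluation respects the
  relations.\<close>

lemma m11_group_iff:
  assumes "group K" "f \<in> hom free_group K"
  shows "m11_group K (f (free_gen Sym_a)) (f (free_gen Sym_T)) (f (free_gen Sym_J)) (f (free_gen Sym_U))
    \<longleftrightarrow> (\<forall>(x, y) \<in> m11_relations. f x = f y)"
proof -
  interpret f: group_hom free_group K f
    using assms group_free_group by (intro group_hom.intro group_hom_axioms.intro)
  show ?thesis
    unfolding m11_group_def m11_group_axioms_def m11_relations_def Let_def
    by (simp add: f.hom_commutator f.hom_conjugate group.commutator_closed group.conjugate_closed group_free_group
        f.hom_nat_pow assms(1))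
qed

lemma m11_group_presented:
  "m11_group (presented_group m11_relations)
     (presented_gen m11_relations Sym_a) (presented_gen m11_relations Sym_T)
     (presented_gen m11_relations Sym_J) (presented_gen m11_relations Sym_U)"
  using m11_group_iff[OF m11.P.is_group m11.presentation_map_hom] m11.relation_holds
  unfolding presented_gen_def by blast

theorem proposition7p3:
  fixes \<zeta> :: "'k::field"
  assumes "CARD('k) = 9"
    and "\<zeta> ^ 2 = 1 - \<zeta>"
  shows "\<exists>h \<in> iso (presented_group m11_relations) (M11 \<zeta>).
           h (presented_gen m11_relations Sym_a) = perm_a \<zeta> \<and>
           h (presented_gen m11_relations Sym_T) = perm_T \<and>
           h (presented_gen m11_relations Sym_J) = perm_J \<and>
           h (presented_gen m11_relations Sym_U) = perm_U \<zeta>"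
proof -
  interpret field_of_order_nine \<zeta>
    using assms by unfold_locales
  define g where "g s = (case s of Sym_a \<Rightarrow> perm_a \<zeta> | Sym_T \<Rightarrow> perm_T | Sym_J \<Rightarrow> perm_J
    | Sym_U \<Rightarrow> perm_U \<zeta>)" for s
  have "g s \<in> carrier (BijGroup UNIV)" for s
    using perms_in_BijGroup by (cases s) (simp_all add: g_def)
  then obtain f where f: "f \<in> hom free_group (BijGroup UNIV)" "\<And>s. f (free_gen s) = g s"
    using group.free_group_universal[OF group_BijGroup] by blast
  \<comment> \<open>The permutations satisfy the relations, so evaluation at them descends to the
    presented group.\<close>
  have "f x = f y" if "(x, y) \<in> m11_relations" for x y
    using that m11_group_iff[OF group_BijGroup f(1)] m11_group_perms by (auto simp: f(2) g_def)
  then obtain h where h: "h \<in> hom (presented_group m11_relations) (BijGroup UNIV)"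
      "\<And>s. h (presented_gen m11_relations s) = f (free_gen s)"
    using m11.presented_group_universal[OF group_BijGroup f(1)] by blast
  have symbols: "UNIV = {Sym_a, Sym_T, Sym_J, Sym_U}"
    using m11_symbol.exhaust by blast
  have "range (presented_gen m11_relations) =
      {presented_gen m11_relations Sym_a, presented_gen m11_relations Sym_T,
       presented_gen m11_relations Sym_J, presented_gen m11_relations Sym_U}"
    unfolding symbols by simp
  note generated = m11.presented_group_generated[unfolded this]
  have gens: "h (presented_gen m11_relations Sym_a) = perm_a \<zeta>"
    "h (presented_gen m11_relations Sym_T) = perm_T"
    "h (presented_gen m11_relations Sym_J) = perm_J"
    "h (presented_gen m11_relations Sym_U) = perm_U \<zeta>"
    by (simp_all add: h(2) f(2) g_def)
  have "m11_action (presented_group m11_relations)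
     (presented_gen m11_relations Sym_a) (presented_gen m11_relations Sym_T)
     (presented_gen m11_relations Sym_J) (presented_gen m11_relations Sym_U) \<zeta> h"
    using m11_group_presented field_of_order_nine_axioms h(1) gens generated
    by (intro m11_action.intro m11_action_axioms.intro) simp_all
  from m11_action.action_iso[OF this] gens show ?thesis
    by blast
qed

end
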